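(* Let $T_t=\sum_{i=0}^m\mathfrak T_it^i$ be an order $m$ deformation of a relative Rota-Baxter operator $T$ on an $n$-LieRep pair $(\mathfrak g,[-,\cdots,-]_{\mathfrak g};\rho)$. Then $T_t$ is extendable if and only if the cohomology class $[\Theta_m]\in\mathcal H^2(V,\mathfrak g)$ is trivial, where $$\Theta_m(u_1,\cdots,u_n)=\sum_{\substack{i_1+\cdots+i_n=m+1\\0\le i_1,\cdots,i_n\le m}}\Big([\mathfrak T_{i_1}u_1,\cdots,\mathfrak T_{i_n}u_n]_{\mathfrak g}-\mathfrak T_{i_1}\big(\sum_{k=1}^n(-1)^{n-k}\rho(\mathfrak T_{i_2}u_1,\cdots,\mathfrak T_{i_k}u_{k-1},\mathfrak T_{i_{k+1}}u_{k+1},\cdots,\mathfrak T_{i_n}u_n)(u_k)\big)\Big).$$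
   Context: All vector spaces are finite dimensional over an algebraically closed field $\mathbb K$ of characteristic $0$; $n\ge2$; a hat denotes omission. An $n$-Lie algebra is a vector space $\mathfrak g$ with a skew-symmetric linear map $[-,\cdots,-]_{\mathfrak g}:\wedge^n\mathfrak g\to\mathfrak g$ such that $[x_1,\cdots,x_{n-1},[y_1,\cdots,y_n]]=\sum_{i=1}^n[y_1,\cdots,y_{i-1},[x_1,\cdots,x_{n-1},y_i],y_{i+1},\cdots,y_n]$. For $\mathfrak X=x_1\wedge\cdots\wedge x_{n-1}$, $\mathfrak Y=y_1\wedge\cdots\wedge y_{n-1}$ write $[\mathfrak X,y]_{\mathfrak g}=[x_1,\cdots,x_{n-1},y]_{\mathfrak g}$ and $\mathfrak X\circ\mathfrak Y=\sum_{i=1}^{n-1}y_1\wedge\cdots\wedge[\mathfrak X,y_i]_{\mathfrak g}\wedge\cdots\wedge y_{n-1}$ (and similarly in any $n$-Lie algebra). A representation on $V$ is a linear map $\rho:\wedge^{n-1}\mathfrak g\to\mathfrak{gl}(V)$ with $[\rho(\mathfrak X),\rho(\mathfrak Y)]=\rho(\mathfrak X\circ\mathfrak Y)$ and $\rho(x_1,\cdots,x_{n-2},[y_1,\cdots,y_n]_{\mathfrak g})=\sum_{i=1}^n(-1)^{n-i}\rho(y_1,\cdots,\widehat{y_i},\cdots,y_n)\rho(x_1,\cdots,x_{n-2},y_i)$. An $n$-LieRep pair is an $n$-Lie algebra with a representation $\rho$ on a vector space $V$. A relative Rota-Baxter operator on it is a linear map $T:V\to\mathfrak g$ with $[Tv_1,\cdots,Tv_n]_{\mathfrak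 g}=\sum_{i=1}^n(-1)^{n-i}T(\rho(Tv_1,\cdots,\widehat{Tv_i},\cdots,Tv_n)(v_i))$. An order $m$ deformation of $T$ is a sequence of linear maps $\mathfrak T_i:V\to\mathfrak g$, $0\le i\le m$, with $\mathfrak T_0=T$, such that the $\mathbb K[t]/(t^{m+1})$-module map $T_t=\sum_{i=0}^m\mathfrak T_it^i:V[t]/(t^{m+1})\to\mathfrak g[t]/(t^{m+1})$ satisfies $[T_tu_1,\cdots,T_tu_n]_{\mathfrak g}=T_t\big(\sum_{i=1}^n(-1)^{n-i}\rho(T_tu_1,\cdots,\widehat{T_tu_i},\cdots,T_tu_n)(u_i)\big)$ for all $u_i\in V$ (bracket and $\rho$ extended $\mathbb K[t]/(t^{m+1})$-multilinearly). It is extendable if there is a linear map $\mathfrak T_{m+1}:V\to\mathfrak g$ such that $T_t+\mathfrak T_{m+1}t^{m+1}$ is an order $m+1$ deformation of $T$. Cohomology of $T$: $V$ is an $n$-Lie algebra under $[u_1,\cdots,u_n]_T=\sum_{i=1}^n(-1)^{n-i}\rho(Tu_1,\cdots,\widehat{Tu_i},\cdots,Tu_n)(u_i)$ (the operations $\circ$ and $[\mathfrak U,u]_T$ below refer to it), and $\rho_T(u_1,\cdots,u_{n-1})x=[Tu_1,\cdots,Tu_{n-1},x]_{\mathfrak g}-\sum_{i=1}^{n-1}(-1)^{n-i}T\rho(Tu_1,\cdots,\widehat{Tu_i},\cdots,Tu_{n-1},x)(u_i)$ is a representation of it on $\mathfrak g$. For $m\ge1$ let $C_T^m(V;\mathfrak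 g)=\mathrm{Hom}(\otimes^{m-1}(\wedge^{n-1}V)\wedge V,\mathfrak g)$, where $\otimes^{p}(\wedge^{n-1}V)\wedge V$ means $V$ for $p=0$ and $\otimes^{p-1}(\wedge^{n-1}V)\otimes\wedge^nV$ for $p\ge1$; $C^0_T(V;\mathfrak g)=\wedge^{n-1}\mathfrak g$. The differential $d:C_T^m\to C_T^{m+1}$ is, for $m=0$, $(d\mathfrak X)(v)=T\rho(\mathfrak X)v-[\mathfrak X,Tv]_{\mathfrak g}$, and for $m\ge1$, with $\mathfrak U_i=u_i^1\wedge\cdots\wedge u_i^{n-1}$, $$(df)(\mathfrak U_1,\cdots,\mathfrak U_m,u)=\sum_{1\le j<k\le m}(-1)^jf(\mathfrak U_1,\cdots,\widehat{\mathfrak U_j},\cdots,\mathfrak U_{k-1},\mathfrak U_j\circ\mathfrak U_k,\mathfrak U_{k+1},\cdots,\mathfrak U_m,u)+\sum_{j=1}^m(-1)^jf(\mathfrak U_1,\cdots,\widehat{\mathfrak U_j},\cdots,\mathfrak U_m,[\mathfrak U_j,u]_T)$$ $$+\sum_{j=1}^m(-1)^{j+1}\rho_T(\mathfrak U_j)f(\mathfrak U_1,\cdots,\widehat{\mathfrak U_j},\cdots,\mathfrak U_m,u)+\sum_{i=1}^{n-1}(-1)^{n+m-i+1}\rho_T(u_m^1,\cdots,\widehat{u_m^i},\cdots,u_m^{n-1},u)f(\mathfrak U_1,\cdots,\mathfrak U_{m-1},u_m^i).$$ $\mathcal H^m(V,\mathfrak g)$ is the $m$-th cohomology group of $(C_T^*(V;\mathfrak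 g),d)$. The cochain $\Theta_m\in C_T^2(V;\mathfrak g)=\mathrm{Hom}(\wedge^nV,\mathfrak g)$ of the claim is a $2$-cocycle, so $[\Theta_m]$ is defined. *)

theory Defs
  imports Complex_Main "HOL-Computational_Algebra.Polynomial" "HOL-Algebra.Coset"
begin

text \<open>
  Vector spaces are types \<open>'g\<close>, \<open>'v\<close> of class \<^class>\<open>ab_group_add\<close> with an explicit scalar
  multiplication by the field \<open>'k\<close>. A linear map out of an exterior power \<open>\<Lambda>\<^sup>k 'a\<close> is an
  alternating multilinear map on lists of length \<open>k\<close>; its values on lists of other lengths carry
  no meaning. List positions count from 0, so an index \<open>i\<close> of the usual formulas
  is \<open>Suc i\<close> here.
\<close>

definition fd_vector_space :: "('k::field \<Rightarrow> 'a::ab_group_add \<Rightarrow> 'a) \<Rightarrow> bool" where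
  "fd_vector_space s \<longleftrightarrow> (\<exists>B. finite_dimensional_vector_space s B)"

definition alternating_multilinear ::
  "nat \<Rightarrow> ('k::field \<Rightarrow> 'a::ab_group_add \<Rightarrow> 'a) \<Rightarrow> ('k \<Rightarrow> 'b::ab_group_add \<Rightarrow> 'b)
    \<Rightarrow> ('a list \<Rightarrow> 'b) \<Rightarrow> bool" where
  "alternating_multilinear k s s' f \<longleftrightarrow>
     (\<forall>xs i. length xs = k \<and> i < k \<longrightarrow> Vector_Spaces.linear s s' (\<lambda>x. f (xs[i := x]))) \<and>
     (\<forall>xs i j. length xs = k \<and> i < j \<and> j < k \<and> xs ! i = xs ! j \<longrightarrow> f xs = 0)"

text \<open>\<open>alt_sign k x\<close> is \<open>(-1)\<^sup>k x\<close>.\<close>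

definition alt_sign :: "nat \<Rightarrow> 'a::ab_group_add \<Rightarrow> 'a" where
  "alt_sign k x = (if even k then x else - x)"

definition omit :: "nat \<Rightarrow> 'a list \<Rightarrow> 'a list" where
  "omit i xs = take i xs @ drop (Suc i) xs"

definition n_Lie_algebra ::
  "nat \<Rightarrow> ('k::field \<Rightarrow> 'g::ab_group_add \<Rightarrow> 'g) \<Rightarrow> ('g list \<Rightarrow> 'g) \<Rightarrow> bool" where
  "n_Lie_algebra n s br \<longleftrightarrow>
     fd_vector_space s \<and> alternating_multilinear n s s br \<and>
     (\<forall>xs ys. length xs = n - 1 \<and> length ys = n \<longrightarrow>
        br (xs @ [br ys]) = (\<Sum>i<n. br (ys[i := br (xs @ [ys ! i])])))"

text \<open>
  \<open>\<XX> \<circ> \<YY>\<close> is a sum of decomposable elements of \<open>\<Lambda>\<^sup>n\<^sup>-\<^sup>1\<close>; it is represented by the list of its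
  summands, and a linear map is applied to it by adding up the values on the summands.
\<close>

definition circ :: "('a list \<Rightarrow> 'a) \<Rightarrow> 'a list \<Rightarrow> 'a list \<Rightarrow> 'a list list" where
  "circ br X Y = map (\<lambda>i. Y[i := br (X @ [Y ! i])]) [0..<length Y]"

definition n_Lie_representation ::
  "nat \<Rightarrow> ('k::field \<Rightarrow> 'g::ab_group_add \<Rightarrow> 'g) \<Rightarrow> ('g list \<Rightarrow> 'g)
    \<Rightarrow> ('k \<Rightarrow> 'v::ab_group_add \<Rightarrow> 'v) \<Rightarrow> ('g list \<Rightarrow> 'v \<Rightarrow> 'v) \<Rightarrow> bool" where
  "n_Lie_representation n sg br sv \<rho> \<longleftrightarrow>
     (\<forall>X. length X = n - 1 \<longrightarrow> Vector_Spaces.linear sv sv (\<rho> X)) \<and>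
     (\<forall>v. alternating_multilinear (n - 1) sg sv (\<lambda>X. \<rho> X v)) \<and>
     (\<forall>X Y v. length X = n - 1 \<and> length Y = n - 1 \<longrightarrow>
        \<rho> X (\<rho> Y v) - \<rho> Y (\<rho> X v) = (\<Sum>Z\<leftarrow>circ br X Y. \<rho> Z v)) \<and>
     (\<forall>xs ys v. length xs = n - 2 \<and> length ys = n \<longrightarrow>
        \<rho> (xs @ [br ys]) v
          = (\<Sum>i<n. alt_sign (n - Suc i) (\<rho> (omit i ys) (\<rho> (xs @ [ys ! i]) v))))"

definition n_LieRep_pair ::
  "nat \<Rightarrow> ('k::field \<Rightarrow> 'g::ab_group_add \<Rightarrow> 'g) \<Rightarrow> ('g list \<Rightarrow> 'g)
    \<Rightarrow> ('k \<Rightarrow> 'v::ab_group_add \<Rightarrow> 'v) \<Rightarrow> ('g list \<Rightarrow> 'v \<Rightarrow> 'v) \<Rightarrow> bool" where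
  "n_LieRep_pair n sg br sv \<rho> \<longleftrightarrow>
     n_Lie_algebra n sg br \<and> fd_vector_space sv \<and> n_Lie_representation n sg br sv \<rho>"

text \<open>The bracket \<open>[u\<^sub>1, \<dots>, u\<^sub>n]\<^sub>T\<close> on \<open>V\<close>; here \<open>n\<close> is the length of \<open>us\<close>.\<close>

definition bracket_T ::
  "('g list \<Rightarrow> 'v::ab_group_add \<Rightarrow> 'v) \<Rightarrow> ('v \<Rightarrow> 'g) \<Rightarrow> 'v list \<Rightarrow> 'v" where
  "bracket_T \<rho> T us =
     (\<Sum>i<length us. alt_sign (length us - Suc i) (\<rho> (map T (omit i us)) (us ! i)))"

definition relative_Rota_Baxter ::
  "nat \<Rightarrow> ('k::field \<Rightarrow> 'g::ab_group_add \<Rightarrow> 'g) \<Rightarrow> ('g list \<Rightarrow> 'g)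
    \<Rightarrow> ('k \<Rightarrow> 'v::ab_group_add \<Rightarrow> 'v) \<Rightarrow> ('g list \<Rightarrow> 'v \<Rightarrow> 'v) \<Rightarrow> ('v \<Rightarrow> 'g) \<Rightarrow> bool" where
  "relative_Rota_Baxter n sg br sv \<rho> T \<longleftrightarrow>
     Vector_Spaces.linear sv sg T \<and>
     (\<forall>us. length us = n \<longrightarrow> br (map T us) = T (bracket_T \<rho> T us))"


subsection \<open>Deformations\<close>

text \<open>
  An element \<open>\<Sum>\<^sub>l a\<^sub>l t\<^sup>l\<close> of \<open>A[t]/(t\<^sup>m\<^sup>+\<^sup>1)\<close> is represented by its coefficient function
  \<open>a :: nat \<Rightarrow> 'a\<close>, with \<open>a l = 0\<close> for \<open>l > m\<close>. The operations below are the
  \<open>K[t]/(t\<^sup>m\<^sup>+\<^sup>1)\<close>-multilinear extensions of the bracket, of \<open>\<rho>\<close> and of \<open>T\<^sub>t = \<Sum>\<^sub>i T\<^sub>i t\<^sup>i\<close>.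
\<close>

definition const_coeffs :: "'a::zero \<Rightarrow> nat \<Rightarrow> 'a" where
  "const_coeffs u l = (if l = 0 then u else 0)"

definition ext_bracket ::
  "nat \<Rightarrow> ('g list \<Rightarrow> 'g::ab_group_add) \<Rightarrow> (nat \<Rightarrow> 'g) list \<Rightarrow> nat \<Rightarrow> 'g" where
  "ext_bracket m br as l =
     (if l \<le> m
      then \<Sum>is\<in>{is. length is = length as \<and> sum_list is = l}. br (map2 (\<lambda>a i. a i) as is)
      else 0)"

definition ext_rho ::
  "nat \<Rightarrow> ('g list \<Rightarrow> 'v \<Rightarrow> 'v::ab_group_add) \<Rightarrow> (nat \<Rightarrow> 'g) list \<Rightarrow> (nat \<Rightarrow> 'v)
    \<Rightarrow> nat \<Rightarrow> 'v" where
  "ext_rho m \<rho> as b l =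
     (if l \<le> m
      then \<Sum>(is, j)\<in>{(is, j). length is = length as \<and> sum_list is + j = l}.
             \<rho> (map2 (\<lambda>a i. a i) as is) (b j)
      else 0)"

definition ext_T ::
  "nat \<Rightarrow> (nat \<Rightarrow> 'v \<Rightarrow> 'g::ab_group_add) \<Rightarrow> (nat \<Rightarrow> 'v) \<Rightarrow> nat \<Rightarrow> 'g" where
  "ext_T m Ts b l = (if l \<le> m then \<Sum>i\<le>l. Ts i (b (l - i)) else 0)"

text \<open>Only the maps \<open>Ts i\<close> with \<open>i \<le> m\<close> matter for an order \<open>m\<close> deformation.\<close>

definition order_deformation ::
  "nat \<Rightarrow> ('k::field \<Rightarrow> 'g::ab_group_add \<Rightarrow> 'g) \<Rightarrow> ('g list \<Rightarrow> 'g)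
    \<Rightarrow> ('k \<Rightarrow> 'v::ab_group_add \<Rightarrow> 'v) \<Rightarrow> ('g list \<Rightarrow> 'v \<Rightarrow> 'v) \<Rightarrow> ('v \<Rightarrow> 'g)
    \<Rightarrow> nat \<Rightarrow> (nat \<Rightarrow> 'v \<Rightarrow> 'g) \<Rightarrow> bool" where
  "order_deformation n sg br sv \<rho> T m Ts \<longleftrightarrow>
     Ts 0 = T \<and> (\<forall>i\<le>m. Vector_Spaces.linear sv sg (Ts i)) \<and>
     (\<forall>us. length us = n \<longrightarrow>
        (let Tt = (\<lambda>u. ext_T m Ts (const_coeffs u)) in
         ext_bracket m br (map Tt us)
           = ext_T m Ts (\<lambda>l. \<Sum>i<n. alt_sign (n - Suc i)
               (ext_rho m \<rho> (map Tt (omit i us)) (const_coeffs (us ! i)) l))))"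

definition extendable ::
  "nat \<Rightarrow> ('k::field \<Rightarrow> 'g::ab_group_add \<Rightarrow> 'g) \<Rightarrow> ('g list \<Rightarrow> 'g)
    \<Rightarrow> ('k \<Rightarrow> 'v::ab_group_add \<Rightarrow> 'v) \<Rightarrow> ('g list \<Rightarrow> 'v \<Rightarrow> 'v) \<Rightarrow> ('v \<Rightarrow> 'g)
    \<Rightarrow> nat \<Rightarrow> (nat \<Rightarrow> 'v \<Rightarrow> 'g) \<Rightarrow> bool" where
  "extendable n sg br sv \<rho> T m Ts \<longleftrightarrow>
     (\<exists>S. Vector_Spaces.linear sv sg S \<and>
          order_deformation n sg br sv \<rho> T (Suc m) (Ts(Suc m := S)))"


subsection \<open>Cohomology of a relative Rota-Baxter operator\<close>

text \<open>The representation \<open>\<rho>\<^sub>T\<close> of \<open>(V, [\<dots>]\<^sub>T)\<close> on \<open>\<gg>\<close>; here \<open>n - 1\<close> is the length of \<open>us\<close>.\<close>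

definition rho_T ::
  "('g list \<Rightarrow> 'g::ab_group_add) \<Rightarrow> ('g list \<Rightarrow> 'v \<Rightarrow> 'v) \<Rightarrow> ('v \<Rightarrow> 'g)
    \<Rightarrow> 'v list \<Rightarrow> 'g \<Rightarrow> 'g" where
  "rho_T br \<rho> T us x =
     br (map T us @ [x]) -
     (\<Sum>i<length us. alt_sign (length us - i) (T (\<rho> (map T (omit i us) @ [x]) (us ! i))))"

text \<open>
  For \<open>m \<ge> 1\<close>, an \<open>m\<close>-cochain is a function of \<open>U\<^sub>1, \<dots>, U\<^sub>m\<^sub>-\<^sub>1\<close> (a list of lists of length
  \<open>n - 1\<close>) and \<open>u\<close>. It is alternating multilinear in each \<open>U\<^sub>k\<close>, linear in \<open>u\<close> and vanishes if
  \<open>u\<close> occurs in the last \<open>U\<^sub>k\<close>, that is, it is alternating in the last \<open>U\<^sub>k\<close> and \<open>u\<close>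
  jointly. It is 0 on arguments of the wrong shape, so that cochains are equal as
  functions exactly if they are equal as multilinear maps.
\<close>

definition cochain_shape :: "nat \<Rightarrow> nat \<Rightarrow> 'v list list \<Rightarrow> bool" where
  "cochain_shape n m Us \<longleftrightarrow> length Us = m - 1 \<and> (\<forall>U\<in>set Us. length U = n - 1)"

definition cochains ::
  "nat \<Rightarrow> ('k::field \<Rightarrow> 'g::ab_group_add \<Rightarrow> 'g) \<Rightarrow> ('k \<Rightarrow> 'v::ab_group_add \<Rightarrow> 'v)
    \<Rightarrow> nat \<Rightarrow> ('v list list \<Rightarrow> 'v \<Rightarrow> 'g) set" where
  "cochains n sg sv m = {f.
     (\<forall>Us u. \<not> cochain_shape n m Us \<longrightarrow> f Us u = 0) \<and>
     (\<forall>Us. cochain_shape n m Us \<longrightarrow> Vector_Spaces.linear sv sg (f Us)) \<and>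
     (\<forall>Us u k. cochain_shape n m Us \<and> k < length Us \<longrightarrow>
        alternating_multilinear (n - 1) sv sg (\<lambda>U. f (Us[k := U]) u)) \<and>
     (\<forall>Us u. cochain_shape n m Us \<and> Us \<noteq> [] \<and> u \<in> set (last Us) \<longrightarrow> f Us u = 0)}"

text \<open>
  The differential of an \<open>m\<close>-cochain, \<open>m \<ge> 1\<close>. With positions counted from 0, the sign
  exponents \<open>j\<close>, \<open>j + 1\<close> and \<open>n + m - i + 1\<close> become \<open>Suc j\<close>, \<open>j\<close> (up to parity) and
  \<open>n + m - i\<close>.
\<close>

definition differential ::
  "nat \<Rightarrow> ('g list \<Rightarrow> 'g::ab_group_add) \<Rightarrow> ('g list \<Rightarrow> 'v::ab_group_add \<Rightarrow> 'v) \<Rightarrow> ('v \<Rightarrow> 'g)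
    \<Rightarrow> nat \<Rightarrow> ('v list list \<Rightarrow> 'v \<Rightarrow> 'g) \<Rightarrow> 'v list list \<Rightarrow> 'v \<Rightarrow> 'g" where
  "differential n br \<rho> T m f Us u =
     (if cochain_shape n (Suc m) Us then
        (\<Sum>k<m. \<Sum>j<k. alt_sign (Suc j)
           (\<Sum>Z\<leftarrow>circ (bracket_T \<rho> T) (Us ! j) (Us ! k). f (omit j (Us[k := Z])) u))
      + (\<Sum>j<m. alt_sign (Suc j) (f (omit j Us) (bracket_T \<rho> T (Us ! j @ [u]))))
      + (\<Sum>j<m. alt_sign j (rho_T br \<rho> T (Us ! j) (f (omit j Us) u)))
      + (\<Sum>i<n - 1. alt_sign (n + m - i)
           (rho_T br \<rho> T (omit i (last Us) @ [u]) (f (butlast Us) (last Us ! i))))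
      else 0)"

text \<open>
  The groups \<open>Z\<^sup>m\<close> for \<open>m \<ge> 1\<close>, and \<open>B\<^sup>m\<close> and \<open>H\<^sup>m = Z\<^sup>m / B\<^sup>m\<close> for \<open>m \<ge> 2\<close>; the cochains
  of degree 0 only contribute to \<open>H\<^sup>0\<close> and \<open>H\<^sup>1\<close>.
\<close>

definition cocycle_group ::
  "nat \<Rightarrow> ('k::field \<Rightarrow> 'g::ab_group_add \<Rightarrow> 'g) \<Rightarrow> ('g list \<Rightarrow> 'g)
    \<Rightarrow> ('k \<Rightarrow> 'v::ab_group_add \<Rightarrow> 'v) \<Rightarrow> ('g list \<Rightarrow> 'v \<Rightarrow> 'v) \<Rightarrow> ('v \<Rightarrow> 'g)
    \<Rightarrow> nat \<Rightarrow> ('v list list \<Rightarrow> 'v \<Rightarrow> 'g) monoid" where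
  "cocycle_group n sg br sv \<rho> T m =
     \<lparr>carrier = {f \<in> cochains n sg sv m. differential n br \<rho> T m f = (\<lambda>Us u. 0)},
      mult = (\<lambda>f g Us u. f Us u + g Us u), one = (\<lambda>Us u. 0)\<rparr>"

definition coboundaries ::
  "nat \<Rightarrow> ('k::field \<Rightarrow> 'g::ab_group_add \<Rightarrow> 'g) \<Rightarrow> ('g list \<Rightarrow> 'g)
    \<Rightarrow> ('k \<Rightarrow> 'v::ab_group_add \<Rightarrow> 'v) \<Rightarrow> ('g list \<Rightarrow> 'v \<Rightarrow> 'v) \<Rightarrow> ('v \<Rightarrow> 'g)
    \<Rightarrow> nat \<Rightarrow> ('v list list \<Rightarrow> 'v \<Rightarrow> 'g) set" where
  "coboundaries n sg br sv \<rho> T m = differential n br \<rho> T (m - 1) ` cochains n sg sv (m - 1)"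

definition cohomology_group ::
  "nat \<Rightarrow> ('k::field \<Rightarrow> 'g::ab_group_add \<Rightarrow> 'g) \<Rightarrow> ('g list \<Rightarrow> 'g)
    \<Rightarrow> ('k \<Rightarrow> 'v::ab_group_add \<Rightarrow> 'v) \<Rightarrow> ('g list \<Rightarrow> 'v \<Rightarrow> 'v) \<Rightarrow> ('v \<Rightarrow> 'g)
    \<Rightarrow> nat \<Rightarrow> ('v list list \<Rightarrow> 'v \<Rightarrow> 'g) set monoid" where
  "cohomology_group n sg br sv \<rho> T m =
     cocycle_group n sg br sv \<rho> T m Mod coboundaries n sg br sv \<rho> T m"

definition cohomology_class ::
  "nat \<Rightarrow> ('k::field \<Rightarrow> 'g::ab_group_add \<Rightarrow> 'g) \<Rightarrow> ('g list \<Rightarrow> 'g)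
    \<Rightarrow> ('k \<Rightarrow> 'v::ab_group_add \<Rightarrow> 'v) \<Rightarrow> ('g list \<Rightarrow> 'v \<Rightarrow> 'v) \<Rightarrow> ('v \<Rightarrow> 'g)
    \<Rightarrow> nat \<Rightarrow> ('v list list \<Rightarrow> 'v \<Rightarrow> 'g) \<Rightarrow> ('v list list \<Rightarrow> 'v \<Rightarrow> 'g) set" where
  "cohomology_class n sg br sv \<rho> T m f =
     coboundaries n sg br sv \<rho> T m #>\<^bsub>cocycle_group n sg br sv \<rho> T m\<^esub> f"


subsection \<open>The obstruction cochain\<close>

definition obstruction ::
  "nat \<Rightarrow> ('g list \<Rightarrow> 'g::ab_group_add) \<Rightarrow> ('g list \<Rightarrow> 'v::ab_group_add \<Rightarrow> 'v)
    \<Rightarrow> nat \<Rightarrow> (nat \<Rightarrow> 'v \<Rightarrow> 'g) \<Rightarrow> 'v list \<Rightarrow> 'g" where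
  "obstruction n br \<rho> m Ts us =
     (\<Sum>is\<in>{is. length is = n \<and> sum_list is = m + 1 \<and> (\<forall>i\<in>set is. i \<le> m)}.
        br (map2 Ts is us) -
        Ts (hd is) (\<Sum>k<n. alt_sign (n - Suc k) (\<rho> (map2 Ts (tl is) (omit k us)) (us ! k))))"

text \<open>\<open>Hom(\<Lambda>\<^sup>n V, \<gg>)\<close> as the space of 2-cochains.\<close>

definition two_cochain :: "nat \<Rightarrow> ('v list \<Rightarrow> 'g::zero) \<Rightarrow> 'v list list \<Rightarrow> 'v \<Rightarrow> 'g" where
  "two_cochain n \<theta> Us u = (if cochain_shape n 2 Us then \<theta> (hd Us @ [u]) else 0)"

end

theory Submission
  imports Defs
begin

text \<open>
  Extending \<open>T\<^sub>t\<close> by \<open>S t\<^sup>m\<^sup>+\<^sup>1\<close> leaves the coefficients of the deformation equation in degrees up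
  to \<open>m\<close> as they were, so everything is decided by the coefficient of \<open>t\<^sup>m\<^sup>+\<^sup>1\<close>. That coefficient is
  a sum over the weak compositions \<open>i\<^sub>1 + \<dots> + i\<^sub>n = m + 1\<close>. Those with all parts at most \<open>m\<close> do not
  involve \<open>S\<close> and add up to \<open>\<Theta>\<^sub>m\<close>. The others have one part \<open>m + 1\<close> and the rest 0; they add up to
  the derivative at \<open>T\<close>, in the direction \<open>S\<close>, of the Rota-Baxter defect
  \<open>[Tu\<^sub>1, \<dots>, Tu\<^sub>n] - T [u\<^sub>1, \<dots>, u\<^sub>n]\<^sub>T\<close>. So \<open>S\<close> extends \<open>T\<^sub>t\<close> exactly if
  \<open>\<Theta>\<^sub>m + linearized_defect T S = 0\<close> (\<open>extendable_iff\<close>, from \<open>order_deformation_iff\<close> and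
  \<open>defect_top\<close>).

  The heart of the matter is that this derivative is the differential \<open>dS\<close> of the 1-cochain \<open>S\<close>
  (\<open>differential_one\<close>). In \<open>dS\<close> the vector \<open>S u\<^sub>i\<close> always occupies the last slot of the bracket or of
  \<open>\<rho>\<close>, with a sign depending on \<open>i\<close>; in the derivative it sits in its natural slot. Moving it there
  by adjacent transpositions (\<open>alternating_omit_snoc\<close>) cancels the signs on the bracket terms. The
  \<open>\<rho>\<close> terms are indexed by an ordered pair of distinct positions, the one whose vector \<open>\<rho>\<close> acts on
  and the one filled by \<open>S\<close>; the two sides enumerate these pairs in opposite orders
  (\<open>double_omission_sum\<close>).

  Hence \<open>T\<^sub>t\<close> is extendable if and only if \<open>\<Theta>\<^sub>m = d(-S)\<close> for some linear \<open>S\<close>. The class of \<open>\<Theta>\<^sub>m\<close> is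
  the coset of \<open>\<Theta>\<^sub>m\<close> modulo the coboundaries, which form an additive group because \<open>d\<close> is additive;
  so this says that the class is trivial (\<open>cohomology_class_trivial_iff\<close>).
\<close>

section \<open>Alternating multilinear maps\<close>

lemma alt_sign_alt_sign: "alt_sign a (alt_sign b x) = alt_sign (a + b) x"
  by (auto simp: alt_sign_def)

lemma alt_sign_cong: "even a = even b \<Longrightarrow> alt_sign a x = alt_sign b x"
  by (simp add: alt_sign_def)

lemma alt_sign_cancel: "alt_sign (a + b + b) x = alt_sign a x"
  by (simp add: alt_sign_def)

lemma alt_sign_diff: "alt_sign a (x - y) = alt_sign a x - alt_sign a y"
  by (simp add: alt_sign_def)

lemma alt_sign_add: "alt_sign a (x + y) = alt_sign a x + alt_sign a y"
  by (simp add: alt_sign_def)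

lemma alt_sign_zero [simp]: "alt_sign a 0 = 0" "alt_sign 0 x = x"
  by (simp_all add: alt_sign_def)

lemma alt_sign_sum: "alt_sign a (\<Sum>i\<in>I. g i) = (\<Sum>i\<in>I. alt_sign a (g i))"
  by (simp add: alt_sign_def sum_negf)

lemma linear_add: "Vector_Spaces.linear s s' f \<Longrightarrow> f (x + y) = f x + f y"
  and linear_zero: "Vector_Spaces.linear s s' f \<Longrightarrow> f 0 = 0"
  and linear_sum: "Vector_Spaces.linear s s' f \<Longrightarrow> f (\<Sum>i\<in>I. h i) = (\<Sum>i\<in>I. f (h i))"
  and linear_alt_sign: "Vector_Spaces.linear s s' f \<Longrightarrow> f (alt_sign a x) = alt_sign a (f x)"
  by (auto simp: linear_iff_module_hom alt_sign_def
      module_hom.add module_hom.zero module_hom.sum module_hom.neg)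

lemma linear_pointwise_add:
  assumes "Vector_Spaces.linear s s' f" "Vector_Spaces.linear s s' g"
  shows "Vector_Spaces.linear s s' (\<lambda>x. f x + g x)"
proof -
  interpret f: Vector_Spaces.linear s s' f by fact
  interpret g: Vector_Spaces.linear s s' g by fact
  show ?thesis
    by unfold_locales
      (simp_all add: f.add g.add f.scale g.scale f.vs2.scale_right_distrib)
qed

lemma linear_pointwise_neg:
  assumes "Vector_Spaces.linear s s' f"
  shows "Vector_Spaces.linear s s' (\<lambda>x. - f x)"
proof -
  interpret f: Vector_Spaces.linear s s' f by fact
  show ?thesis by unfold_locales (simp_all add: f.add f.scale)
qed

lemma alternating_multilinear_linear:
  assumes "alternating_multilinear k s s' f" "length as + Suc (length bs) = k"
  shows "Vector_Spaces.linear s s' (\<lambda>x. f (as @ x # bs))"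
proof -
  have "Vector_Spaces.linear s s' (\<lambda>x. f ((as @ 0 # bs)[length as := x]))"
    using assms unfolding alternating_multilinear_def
    by (metis length_append length_Cons less_add_same_cancel1 zero_less_Suc)
  then show ?thesis by simp
qed

text \<open>
  The expansion of \<open>f(\<dots>, x + y, x + y, \<dots>) = 0\<close>.
\<close>

lemma alternating_swap:
  assumes f: "alternating_multilinear k s s' f" and k: "length as + Suc (Suc (length bs)) = k"
  shows "f (as @ x # y # bs) = - f (as @ y # x # bs)"
proof -
  define g where "g a b = f (as @ a # b # bs)" for a b
  have add1: "g (a + a') b = g a b + g a' b" for a a' b
    using linear_add[OF alternating_multilinear_linear[OF f, of as "b # bs"]] k by (simp add: g_def)
  have add2: "g a (b + b') = g a b + g a b'" for a b b'
    using linear_add[OF alternating_multilinear_linear[OF f, of "as @ [a]" bs]] k by (simp add: g_def)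
  have diag: "g a a = 0" for a
  proof -
    have "\<forall>xs i j. length xs = k \<and> i < j \<and> j < k \<and> xs ! i = xs ! j \<longrightarrow> f xs = 0"
      using f by (simp add: alternating_multilinear_def)
    from this[rule_format, of "as @ a # a # bs" "length as" "Suc (length as)"] k
    show ?thesis by (simp add: g_def nth_append)
  qed
  have "0 = g x y + g y x"
    using diag[of "x + y", unfolded add1 add2] by (simp add: diag add.commute)
  then show ?thesis unfolding g_def by (metis eq_neg_iff_add_eq_0)
qed

text \<open>
  The last argument travels to the left through \<open>bs\<close> by \<open>length bs\<close> adjacent transpositions.
\<close>

lemma alternating_move:
  assumes f: "alternating_multilinear k s s' f"
  shows "length as + Suc (length bs) = k \<Longrightarrow>
    f (as @ bs @ [x]) = alt_sign (length bs) (f (as @ x # bs))"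
proof (induction bs arbitrary: as)
  case Nil
  then show ?case by simp
next
  case (Cons b bs)
  have "f (as @ b # bs @ [x]) = alt_sign (length bs) (f (as @ b # x # bs))"
    using Cons.IH[of "as @ [b]"] Cons.prems by simp
  also have "f (as @ b # x # bs) = - f (as @ x # b # bs)"
    using Cons.prems by (intro alternating_swap[OF f]) simp
  finally show ?case by (simp add: alt_sign_def)
qed

subsection \<open>Omitting and replacing arguments\<close>

lemma length_omit: "i < length xs \<Longrightarrow> length (omit i xs) = length xs - 1"
  by (simp add: omit_def)

lemma map_omit: "map h (omit i xs) = omit i (map h xs)"
  by (simp add: omit_def take_map drop_map)

text \<open>
  This is what relates \<^const>\<open>rho_T\<close> to replacing an argument in place: in the former, the element
  acted upon comes last.
\<close>

lemma alternating_omit_snoc: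
  assumes f: "alternating_multilinear k s s' f" and "length xs = k" "i < k"
  shows "f (omit i xs @ [x]) = alt_sign (k - Suc i) (f (xs[i := x]))"
  using alternating_move[OF f, of "take i xs" "drop (Suc i) xs" x] assms
  by (simp add: omit_def upd_conv_take_nth_drop)

lemma nth_omit:
  "i < length xs \<Longrightarrow> q < length xs - 1 \<Longrightarrow> omit i xs ! q = xs ! (if q < i then q else Suc q)"
  by (auto simp: omit_def nth_append min_def)

text \<open>
  The simplicial identity: after position \<open>p\<close> is gone, the later position \<open>i\<close> is called \<open>i - 1\<close>.
\<close>

lemma omit_omit:
  assumes "p < i" "i < length xs"
  shows "omit p (omit i xs) = omit (i - 1) (omit p xs)"
  using assms by (intro nth_equalityI) (auto simp: length_omit nth_omit)

section \<open>The differential of a 1-cochain as a linearized Rota-Baxter defect\<close>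

text \<open>
  The multilinear algebra of an \<open>n\<close>-LieRep pair, on which both the comparison of coefficients and
  the computation of \<open>dS\<close> for a 1-cochain \<open>S\<close> rest.
\<close>

locale lie_rep_data =
  fixes n :: nat
    and sg :: "'k::field \<Rightarrow> 'g::ab_group_add \<Rightarrow> 'g"
    and sv :: "'k \<Rightarrow> 'v::ab_group_add \<Rightarrow> 'v"
    and br :: "'g list \<Rightarrow> 'g"
    and \<rho> :: "'g list \<Rightarrow> 'v \<Rightarrow> 'v"
  assumes n_pos: "n > 0"
    and br_alternating: "alternating_multilinear n sg sg br"
    and rho_linear: "length X = n - 1 \<Longrightarrow> Vector_Spaces.linear sv sv (\<rho> X)"
    and rho_alternating: "alternating_multilinear (n - 1) sg sv (\<lambda>X. \<rho> X v)"
begin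

text \<open>
  The derivative at \<open>T\<close> in the direction \<open>S\<close> of the map
  \<open>T \<mapsto> [Tu\<^sub>1, \<dots>, Tu\<^sub>n] - T [u\<^sub>1, \<dots>, u\<^sub>n]\<^sub>T\<close>, by the product rule: one occurrence of \<open>T\<close> at a
  time is replaced by \<open>S\<close>. The last sum covers the occurrences inside \<open>\<rho>\<close>.
\<close>

definition linearized_defect :: "('v \<Rightarrow> 'g) \<Rightarrow> ('v \<Rightarrow> 'g) \<Rightarrow> 'v list \<Rightarrow> 'g" where
  "linearized_defect T S us =
     (\<Sum>j<n. br ((map T us)[j := S (us ! j)])) - S (bracket_T \<rho> T us) -
     (\<Sum>q<n - 1. T (\<Sum>k<n. alt_sign (n - Suc k)
        (\<rho> ((map T (omit k us))[q := S (omit k us ! q)]) (us ! k))))"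

lemma linearized_defect_add:
  assumes T: "Vector_Spaces.linear sv sg T" and us: "length us = n"
  shows "linearized_defect T (\<lambda>u. R u + S u) us
    = linearized_defect T R us + linearized_defect T S us"
proof -
  have br: "br (xs[j := x + y]) = br (xs[j := x]) + br (xs[j := y])"
    if "length xs = n" "j < n" for xs j x y
    by (rule linear_add[of sg sg "\<lambda>x. br (xs[j := x])"])
      (use br_alternating that in \<open>simp add: alternating_multilinear_def\<close>)
  have \<rho>: "\<rho> (xs[j := x + y]) v = \<rho> (xs[j := x]) v + \<rho> (xs[j := y]) v"
    if "length xs = n - 1" "j < n - 1" for xs j x y v
    by (rule linear_add[of sg sv "\<lambda>x. \<rho> (xs[j := x]) v"])
      (use rho_alternating that in \<open>simp add: alternating_multilinear_def\<close>)
  show ?thesis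
    using us
    by (simp add: linearized_defect_def br \<rho> length_omit alt_sign_add linear_add[OF T]
        sum.distrib algebra_simps)
qed

lemma linearized_defect_zero:
  assumes "Vector_Spaces.linear sv sg T" "length us = n"
  shows "linearized_defect T (\<lambda>u. 0) us = 0"
  using linearized_defect_add[OF assms, of "\<lambda>u. 0" "\<lambda>u. 0"] by simp

lemma linearized_defect_neg:
  assumes "Vector_Spaces.linear sv sg T" "length us = n"
  shows "linearized_defect T (\<lambda>u. - S u) us = - linearized_defect T S us"
  using linearized_defect_add[OF assms, of S "\<lambda>u. - S u"] linearized_defect_zero[OF assms]
  by (simp add: eq_neg_iff_add_eq_0 add.commute)

text \<open>
  The bracket term of \<open>\<rho>\<^sub>T\<close> with \<open>x\<close> moved from the last slot to slot \<open>i\<close>; the sign on the left is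
  the one with which such terms occur in the differential.
\<close>

lemma rho_T_slot:
  assumes T: "Vector_Spaces.linear sv sg T" and us: "length us = n" and i: "i < n"
  shows "alt_sign (n - Suc i) (rho_T br \<rho> T (omit i us) x)
    = br ((map T us)[i := x])
      - (\<Sum>p<n - 1. alt_sign (n - Suc i + (n - Suc p))
           (T (\<rho> (omit p (map T (omit i us)) @ [x]) (omit i us ! p))))"
proof -
  have "alt_sign (n - Suc i) (br (omit i (map T us) @ [x])) = br ((map T us)[i := x])"
    using us i
    by (simp add: alternating_omit_snoc[OF br_alternating] alt_sign_alt_sign alt_sign_def)
  then show ?thesis
    using us i
    by (simp add: rho_T_def alt_sign_diff alt_sign_sum alt_sign_alt_sign map_omit length_omit)
qed

text \<open>
  Both sides run over the ordered pairs of distinct positions of \<open>us\<close>: position \<open>k\<close> holds the vector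
  acted upon, and \<open>S\<close> is applied at position \<open>i\<close>. On the left \<open>i\<close> is removed first and \<open>p\<close> names
  \<open>k\<close> among the remaining positions; on the right \<open>k\<close> is removed first and \<open>q\<close> names \<open>i\<close>. The signs
  differ because on the left \<open>S u\<^sub>i\<close> stands in the last slot of \<open>\<rho>\<close>.
\<close>

lemma double_omission_sum:
  fixes F :: "'v \<Rightarrow> 'b::ab_group_add"
  assumes us: "length us = n"
    and F: "\<And>a x. F (alt_sign a x) = alt_sign a (F x)"
  shows "(\<Sum>i<n. \<Sum>p<n - 1. alt_sign (n - Suc i + (n - Suc p))
           (F (\<rho> (omit p (map T (omit i us)) @ [S (us ! i)]) (omit i us ! p))))
    = (\<Sum>k<n. \<Sum>q<n - 1. alt_sign (n - Suc k) (F (\<rho> ((map T (omit k us))[q := S (omit k us ! q)]) (us ! k))))"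
    (is "(\<Sum>i<n. \<Sum>p<n - 1. ?l i p) = (\<Sum>k<n. \<Sum>q<n - 1. ?r k q)")
proof -
  \<comment> \<open>The same formula renames the pairs in both directions: \<open>\<phi>\<close> is an involution.\<close>
  define \<phi> :: "nat \<times> nat \<Rightarrow> nat \<times> nat"
    where "\<phi> = (\<lambda>(i, p). if p < i then (p, i - 1) else (Suc p, i))"
  have r: "?r k q = alt_sign (n - Suc k + (n - Suc (Suc q)))
      (F (\<rho> (omit q (map T (omit k us)) @ [S (omit k us ! q)]) (us ! k)))"
    if "k < n" "q < n - 1" for k q
  proof -
    have "length (map T (omit k us)) = n - 1"
      using us that by (simp add: length_omit)
    from alternating_omit_snoc[OF rho_alternating this that(2)]
    have "\<rho> (omit q (map T (omit k us)) @ [x]) v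
        = alt_sign (n - Suc (Suc q)) (\<rho> ((map T (omit k us))[q := x]) v)" for x v
      by simp
    then show ?thesis
      by (simp only: F alt_sign_alt_sign alt_sign_cancel)
  qed
  have "(\<Sum>(i, p)\<in>{..<n} \<times> {..<n - 1}. ?l i p) = (\<Sum>(k, q)\<in>{..<n} \<times> {..<n - 1}. ?r k q)"
  proof (rule sum.reindex_bij_witness[of _ \<phi> \<phi>])
    fix a :: "nat \<times> nat" assume a: "a \<in> {..<n} \<times> {..<n - 1}"
    then show "\<phi> (\<phi> a) = a" "\<phi> a \<in> {..<n} \<times> {..<n - 1}"
      by (auto simp: \<phi>_def split: if_splits)
    then show "\<phi> (\<phi> a) = a" "\<phi> a \<in> {..<n} \<times> {..<n - 1}" by auto
    obtain i p where ip: "a = (i, p)" "i < n" "p < n - 1" using a by auto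
    show "(case \<phi> a of (k, q) \<Rightarrow> ?r k q) = (case a of (i, p) \<Rightarrow> ?l i p)"
    proof (cases "p < i")
      case True
      then have oo: "omit (i - 1) (omit p us) = omit p (omit i us)"
        using ip us by (intro omit_omit[symmetric]) auto
      have nth: "omit p us ! (i - 1) = us ! i" "omit i us ! p = us ! p"
        using True ip us by (auto simp: nth_omit)
      have "(case \<phi> a of (k, q) \<Rightarrow> ?r k q) = ?r p (i - 1)"
        using True ip by (simp add: \<phi>_def)
      also have "\<dots> = alt_sign (n - Suc p + (n - Suc (Suc (i - 1))))
          (F (\<rho> (omit (i - 1) (map T (omit p us)) @ [S (omit p us ! (i - 1))]) (us ! p)))"
        using True ip by (intro r) auto
      also have "\<dots> = ?l i p"
        unfolding map_omit[symmetric] oo nth using True by (simp add: add.commute)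
      finally show ?thesis unfolding ip(1) prod.case .
    next
      case False
      then have oo: "omit i (omit (Suc p) us) = omit p (omit i us)"
        using omit_omit[of i "Suc p" us] ip us by auto
      have nth: "omit (Suc p) us ! i = us ! i" "omit i us ! p = us ! Suc p"
        using False ip us by (simp_all add: nth_omit)
      have "(case \<phi> a of (k, q) \<Rightarrow> ?r k q) = ?r (Suc p) i"
        using False ip by (simp add: \<phi>_def)
      also have "\<dots> = alt_sign (n - Suc (Suc p) + (n - Suc (Suc i)))
          (F (\<rho> (omit i (map T (omit (Suc p) us)) @ [S (omit (Suc p) us ! i)]) (us ! Suc p)))"
        using False ip by (intro r) auto
      also have "\<dots> = ?l i p"
        unfolding map_omit[symmetric] oo nth
        using False ip by (intro alt_sign_cong) auto
      finally show ?thesis unfolding ip(1) prod.case .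
    qed
  qed
  then show ?thesis by (simp only: sum.cartesian_product)
qed

text \<open>
  For \<open>m = 1\<close> the third and the fourth sum of the differential merge into one sum over all \<open>n\<close>
  positions of \<open>us = U @ [u]\<close>, because the third one is the summand for the last position. Then
  \<open>S u\<^sub>i\<close> is moved to slot \<open>i\<close>.
\<close>

lemma differential_one:
  assumes T: "Vector_Spaces.linear sv sg T"
  shows "differential n br \<rho> T 1 f = two_cochain n (linearized_defect T (f []))"
proof (intro ext)
  fix Us u
  show "differential n br \<rho> T 1 f Us u = two_cochain n (linearized_defect T (f [])) Us u"
  proof (cases "cochain_shape n 2 Us")
    case False
    then show ?thesis by (simp add: differential_def two_cochain_def numeral_2_eq_2)
  next
    case True
    then obtain U where Us: "Us = [U]" and U: "length U = n - 1"
      by (auto simp: cochain_shape_def length_Suc_conv)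
    define us where "us = U @ [u]"
    have us: "length us = n" and n: "n = Suc (n - 1)" using U n_pos by (auto simp: us_def)
    have last: "omit (n - 1) us = U" "us ! (n - 1) = u"
      using U by (simp_all add: us_def omit_def nth_append)
    have front: "omit i us = omit i U @ [u]" "us ! i = U ! i" if "i < n - 1" for i
      using U that by (simp_all add: us_def omit_def nth_append)
    have o: "omit 0 [U] = []" by (simp add: omit_def)
    define S where "S = f []"
    have "differential n br \<rho> T 1 f Us u = - S (bracket_T \<rho> T us) +
       (rho_T br \<rho> T U (S u) +
        (\<Sum>i<n - 1. alt_sign (n + 1 - i) (rho_T br \<rho> T (omit i U @ [u]) (S (U ! i)))))"
      using True by (simp add: differential_def Us S_def us_def o numeral_2_eq_2 alt_sign_def[of "Suc 0"])
    also have "rho_T br \<rho> T U (S u) =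
        alt_sign (n - Suc (n - 1)) (rho_T br \<rho> T (omit (n - 1) us) (S (us ! (n - 1))))"
      using last n by simp
    also have "(\<Sum>i<n - 1. alt_sign (n + 1 - i) (rho_T br \<rho> T (omit i U @ [u]) (S (U ! i)))) =
        (\<Sum>i<n - 1. alt_sign (n - Suc i) (rho_T br \<rho> T (omit i us) (S (us ! i))))"
      by (intro sum.cong refl) (auto simp: front intro!: alt_sign_cong)
    also have "alt_sign (n - Suc (n - 1)) (rho_T br \<rho> T (omit (n - 1) us) (S (us ! (n - 1)))) + \<dots>
        = (\<Sum>i<n. alt_sign (n - Suc i) (rho_T br \<rho> T (omit i us) (S (us ! i))))"
      by (subst (6) n) (simp only: sum.lessThan_Suc add.commute)
    also have "\<dots> = (\<Sum>i<n. br ((map T us)[i := S (us ! i)]))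
      - (\<Sum>i<n. \<Sum>p<n - 1. alt_sign (n - Suc i + (n - Suc p))
           (T (\<rho> (omit p (map T (omit i us)) @ [S (us ! i)]) (omit i us ! p))))"
      by (simp add: rho_T_slot[OF T us] sum_subtractf)
    also have "(\<Sum>i<n. \<Sum>p<n - 1. alt_sign (n - Suc i + (n - Suc p))
           (T (\<rho> (omit p (map T (omit i us)) @ [S (us ! i)]) (omit i us ! p))))
       = (\<Sum>q<n - 1. T (\<Sum>k<n. alt_sign (n - Suc k)
           (\<rho> ((map T (omit k us))[q := S (omit k us ! q)]) (us ! k))))"
      unfolding double_omission_sum[OF us linear_alt_sign[OF T]]
      by (subst sum.swap) (simp add: linear_sum[OF T] linear_alt_sign[OF T])
    also have "- S (bracket_T \<rho> T us) + ((\<Sum>i<n. br ((map T us)[i := S (us ! i)])) -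
        (\<Sum>q<n - 1. T (\<Sum>k<n. alt_sign (n - Suc k)
           (\<rho> ((map T (omit k us))[q := S (omit k us ! q)]) (us ! k)))))
       = linearized_defect T S us"
      by (simp add: linearized_defect_def)
    finally show ?thesis using True by (simp add: two_cochain_def Us us_def S_def)
  qed
qed

lemma two_cochain_eq_iff:
  fixes \<theta> \<theta>' :: "'v list \<Rightarrow> 'g"
  shows "two_cochain n \<theta> = two_cochain n \<theta>' \<longleftrightarrow> (\<forall>us. length us = n \<longrightarrow> \<theta> us = \<theta>' us)"
proof
  assume eq: "two_cochain n \<theta> = two_cochain n \<theta>'"
  show "\<forall>us. length us = n \<longrightarrow> \<theta> us = \<theta>' us"
  proof (intro allI impI)
    fix us :: "'v list" assume us: "length us = n"
    have "us = butlast us @ [last us]" using us n_pos by (metis append_butlast_last_id length_0_conv less_numeral_extra(3))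
    then show "\<theta> us = \<theta>' us"
      using fun_cong[OF fun_cong[OF eq, of "[butlast us]"], of "last us"] us
      by (simp add: two_cochain_def cochain_shape_def)
  qed
next
  assume "\<forall>us. length us = n \<longrightarrow> \<theta> us = \<theta>' us"
  then show "two_cochain n \<theta> = two_cochain n \<theta>'"
    using n_pos by (auto simp: two_cochain_def cochain_shape_def fun_eq_iff length_Suc_conv)
qed

text \<open>
  A 1-cochain is determined by its value on the empty list, an arbitrary linear map.
\<close>

lemma coboundaries_two:
  assumes T: "Vector_Spaces.linear sv sg T"
  shows "coboundaries n sg br sv \<rho> T 2
    = {two_cochain n (linearized_defect T S) |S. Vector_Spaces.linear sv sg S}"
proof -
  have "(\<lambda>f. f []) ` cochains n sg sv 1 = {S. Vector_Spaces.linear sv sg S}"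
  proof (intro equalityI subsetI)
    fix S assume "S \<in> {S. Vector_Spaces.linear sv sg S}"
    then have "(\<lambda>Us. if Us = [] then S else (\<lambda>u. 0)) \<in> cochains n sg sv 1"
      by (auto simp: cochains_def cochain_shape_def)
    then show "S \<in> (\<lambda>f. f []) ` cochains n sg sv 1"
      by (rule rev_image_eqI) simp
  qed (auto simp: cochains_def cochain_shape_def)
  then have "{two_cochain n (linearized_defect T S) |S. Vector_Spaces.linear sv sg S}
      = (\<lambda>S. two_cochain n (linearized_defect T S)) ` (\<lambda>f. f []) ` cochains n sg sv 1"
    by auto
  then show ?thesis
    by (simp add: coboundaries_def image_image differential_one[OF T, simplified])
qed

subsection \<open>Triviality of a class in degree 2\<close>

text \<open>
  The coboundaries are closed under sums and differences since \<^const>\<open>linearized_defect\<close> is additive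
  in the direction, so translation by \<open>\<Theta>\<close> maps them onto themselves as soon as \<open>\<Theta>\<close> is one of them;
  conversely \<open>\<Theta>\<close> is the translate of 0.
\<close>

lemma cohomology_class_trivial_iff:
  assumes T: "Vector_Spaces.linear sv sg T"
  shows "cohomology_class n sg br sv \<rho> T 2 (two_cochain n \<Theta>)
      = \<one>\<^bsub>cohomology_group n sg br sv \<rho> T 2\<^esub>
    \<longleftrightarrow> (\<exists>S. Vector_Spaces.linear sv sg S \<and>
          (\<forall>us. length us = n \<longrightarrow> \<Theta> us = linearized_defect T S us))"
proof -
  define B where "B = coboundaries n sg br sv \<rho> T 2"
  have B: "two_cochain n \<theta> \<in> B \<longleftrightarrow> (\<exists>S. Vector_Spaces.linear sv sg S \<and>
      (\<forall>us. length us = n \<longrightarrow> \<theta> us = linearized_defect T S us))" for \<theta>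
    by (auto simp: B_def coboundaries_two[OF T] two_cochain_eq_iff)
  have B_two_cochain: "\<exists>\<theta>. f = two_cochain n \<theta>" if "f \<in> B" for f
    using that by (auto simp: B_def coboundaries_two[OF T])
  have "cohomology_class n sg br sv \<rho> T 2 (two_cochain n \<Theta>)
        = \<one>\<^bsub>cohomology_group n sg br sv \<rho> T 2\<^esub>
      \<longleftrightarrow> (\<lambda>f. (\<lambda>Us u. f Us u + two_cochain n \<Theta> Us u)) ` B = B"
    by (simp add: cohomology_class_def cohomology_group_def r_coset_def cocycle_group_def
        B_def UNION_singleton_eq_range)
  also have "\<dots> \<longleftrightarrow> two_cochain n \<Theta> \<in> B"
  proof
    assume eq: "(\<lambda>f. (\<lambda>Us u. f Us u + two_cochain n \<Theta> Us u)) ` B = B"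
    have linear_0: "Vector_Spaces.linear sv sg (\<lambda>u. 0)"
      using linear_pointwise_add[OF T linear_pointwise_neg[OF T]] by simp
    have "two_cochain n (\<lambda>us. 0) \<in> B"
      unfolding B using linear_0 linearized_defect_zero[OF T] by (intro exI[of _ "\<lambda>u. 0"]) simp
    from imageI[OF this, of "\<lambda>f. (\<lambda>Us u. f Us u + two_cochain n \<Theta> Us u)"]
    have "(\<lambda>Us u. two_cochain n (\<lambda>us. 0) Us u + two_cochain n \<Theta> Us u) \<in> B"
      unfolding eq .
    moreover have "two_cochain n (\<lambda>us. 0) = (\<lambda>(Us :: 'v list list) u. 0::'g)"
      by (simp add: two_cochain_def fun_eq_iff)
    ultimately show "two_cochain n \<Theta> \<in> B" by simp
  next
    assume "two_cochain n \<Theta> \<in> B"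
    then obtain R where R: "Vector_Spaces.linear sv sg R"
      "\<And>us. length us = n \<Longrightarrow> \<Theta> us = linearized_defect T R us"
      by (auto simp: B)
    have shift: "(\<lambda>Us u. two_cochain n \<theta> Us u + two_cochain n \<Theta> Us u)
        = two_cochain n (\<lambda>us. \<theta> us + \<Theta> us)" for \<theta>
      by (simp add: two_cochain_def fun_eq_iff)
    show "(\<lambda>f. (\<lambda>Us u. f Us u + two_cochain n \<Theta> Us u)) ` B = B" (is "?s ` B = B")
    proof (intro equalityI subsetI)
      fix g assume "g \<in> ?s ` B"
      then obtain \<theta> where \<theta>: "two_cochain n \<theta> \<in> B" and g: "g = two_cochain n (\<lambda>us. \<theta> us + \<Theta> us)"
        using B_two_cochain shift by blast
      obtain S where "Vector_Spaces.linear sv sg S"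
        "\<And>us. length us = n \<Longrightarrow> \<theta> us = linearized_defect T S us"
        using \<theta> by (auto simp: B)
      then show "g \<in> B"
        unfolding g B using R
        by (intro exI[of _ "\<lambda>u. S u + R u"]) (simp add: linear_pointwise_add linearized_defect_add[OF T])
    next
      fix g assume g: "g \<in> B"
      then obtain \<theta> where \<theta>: "g = two_cochain n \<theta>" using B_two_cochain by blast
      obtain S where S: "Vector_Spaces.linear sv sg S"
        "\<And>us. length us = n \<Longrightarrow> \<theta> us = linearized_defect T S us"
        using g by (auto simp: \<theta> B)
      have "\<theta> us - \<Theta> us = linearized_defect T (\<lambda>u. S u + - R u) us" if "length us = n" for us
        unfolding linearized_defect_add[OF T that] linearized_defect_neg[OF T that] S(2)[OF that] R(2)[OF that] by simp
      then have "two_cochain n (\<lambda>us. \<theta> us - \<Theta> us) \<in> B"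
        unfolding B using linear_pointwise_add[OF S(1) linear_pointwise_neg[OF R(1)]]
        by (intro exI[of _ "\<lambda>u. S u + - R u"] conjI) simp_all
      then show "g \<in> ?s ` B"
        by (rule rev_image_eqI) (simp add: shift \<theta>)
    qed
  qed
  also have "\<dots> \<longleftrightarrow> (\<exists>S. Vector_Spaces.linear sv sg S \<and>
      (\<forall>us. length us = n \<longrightarrow> \<Theta> us = linearized_defect T S us))"
    by (rule B)
  finally show ?thesis .
qed

end

section \<open>Coefficients of the deformation equation\<close>

definition weak_compositions :: "nat \<Rightarrow> nat \<Rightarrow> nat list set" where
  "weak_compositions k l = {is. length is = k \<and> sum_list is = l}"

lemma finite_weak_compositions: "finite (weak_compositions k l)"
proof (rule finite_subset)
  show "weak_compositions k l \<subseteq> {is. set is \<subseteq> {..l} \<and> length is = k}"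
    by (auto simp: weak_compositions_def member_le_sum_list)
  show "finite {is. set is \<subseteq> {..l} \<and> length is = k}"
    by (rule finite_lists_length_eq) simp
qed

text \<open>
  Splitting off the first part: it is the power of \<open>t\<close> contributed by the outer \<open>T\<^sub>t\<close> in
  \<open>T\<^sub>t (\<Sum> \<rho>(T\<^sub>t u, \<dots>) u)\<close>.
\<close>

lemma sum_weak_compositions_Suc:
  "(\<Sum>is\<in>weak_compositions (Suc k) l. h (hd is) (tl is))
    = (\<Sum>i\<le>l. \<Sum>js\<in>weak_compositions k (l - i). h i js)"
proof -
  have "(\<Sum>i\<le>l. \<Sum>js\<in>weak_compositions k (l - i). h i js)
      = (\<Sum>(i, js)\<in>Sigma {..l} (\<lambda>i. weak_compositions k (l - i)). h i js)"
    by (rule sum.Sigma) (simp_all add: finite_weak_compositions)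
  also have "\<dots> = (\<Sum>is\<in>weak_compositions (Suc k) l. h (hd is) (tl is))"
    by (rule sum.reindex_bij_witness[of _ "\<lambda>is. (hd is, tl is)" "\<lambda>(i, js). i # js"])
      (auto simp: weak_compositions_def length_Suc_conv)
  finally show ?thesis ..
qed

text \<open>
  A part exceeding \<open>m\<close> must be \<open>m + 1\<close> itself and leaves 0 for all others.
\<close>

lemma weak_compositions_top:
  "weak_compositions k (Suc m)
    = {is. length is = k \<and> sum_list is = m + 1 \<and> (\<forall>i\<in>set is. i \<le> m)}
      \<union> (\<lambda>j. (replicate k 0)[j := Suc m]) ` {..<k}" (is "?W = ?A \<union> ?B")
proof (intro equalityI subsetI)
  fix "is" assume W: "is \<in> ?W"
  show "is \<in> ?A \<union> ?B"
  proof (cases "\<forall>i\<in>set is. i \<le> m")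
    case False
    then obtain j where j: "j < k" "is ! j > m"
      using W by (auto simp: weak_compositions_def in_set_conv_nth not_le)
    have "is ! j \<le> Suc m"
      using W j member_le_sum_list[of "is ! j" "is"] by (simp add: weak_compositions_def)
    then have top: "is ! j = Suc m" using j by simp
    have "sum_list (is[j := 0]) = 0"
      using W j top by (simp add: weak_compositions_def sum_list_update)
    then have zero: "\<forall>i\<in>set (is[j := 0]). i = 0" by simp
    have "is[j := 0] = replicate k 0"
      using W zero by (intro replicate_eqI) (auto simp: weak_compositions_def)
    then have "is = (replicate k 0)[j := Suc m]"
      by (metis list_update_id list_update_overwrite top)
    then show ?thesis using j by auto
  qed (use W in \<open>auto simp: weak_compositions_def\<close>)
qed (auto simp: weak_compositions_def sum_list_update)

lemma sum_weak_compositions_top: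
  "(\<Sum>is\<in>weak_compositions k (Suc m). h is)
    = (\<Sum>is\<in>{is. length is = k \<and> sum_list is = m + 1 \<and> (\<forall>i\<in>set is. i \<le> m)}. h is)
      + (\<Sum>j<k. h ((replicate k 0)[j := Suc m]))"
proof -
  let ?A = "{is. length is = k \<and> sum_list is = m + 1 \<and> (\<forall>i\<in>set is. i \<le> m)}"
  let ?e = "\<lambda>j. (replicate k 0)[j := Suc m]"
  have "inj_on ?e {..<k}"
  proof (rule inj_onI)
    fix i j assume "i \<in> {..<k}" "j \<in> {..<k}" "?e i = ?e j"
    then have "?e j ! i = Suc m" by (metis length_replicate lessThan_iff nth_list_update_eq)
    then show "i = j"
      using \<open>i \<in> {..<k}\<close> \<open>j \<in> {..<k}\<close> by (cases "i = j") auto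
  qed
  then have "(\<Sum>is\<in>?e ` {..<k}. h is) = (\<Sum>j<k. h (?e j))"
    by (simp add: sum.reindex)
  moreover have "?A \<inter> ?e ` {..<k} = {}"
  proof -
    have "Suc m \<in> set (?e j)" if "j < k" for j
      using that by (simp add: set_update_memI)
    then show ?thesis by fastforce
  qed
  moreover have "finite ?A"
    by (rule finite_subset[OF _ finite_weak_compositions[of k "m + 1"]])
      (auto simp: weak_compositions_def)
  ultimately show ?thesis
    unfolding weak_compositions_top by (subst sum.union_disjoint) auto
qed

lemma map2_single_index:
  assumes "j < length xs"
  shows "map2 Rs ((replicate (length xs) 0)[j := l]) xs = (map (Rs 0) xs)[j := Rs l (xs ! j)]"
  using assms by (intro nth_equalityI) (auto simp: nth_list_update)

context lie_rep_data
begin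

text \<open>
  The contribution of one weak composition to the coefficient of \<open>t\<^sup>l\<close> in
  \<open>[T\<^sub>t u\<^sub>1, \<dots>, T\<^sub>t u\<^sub>n] - T\<^sub>t (\<dots>)\<close>. In the second term the head of the composition belongs to the outer
  \<open>T\<^sub>t\<close> and the tail to the \<open>n - 1\<close> arguments of \<open>\<rho>\<close>.
\<close>

definition defect_summand :: "(nat \<Rightarrow> 'v \<Rightarrow> 'g) \<Rightarrow> 'v list \<Rightarrow> nat list \<Rightarrow> 'g" where
  "defect_summand Ts us is = br (map2 Ts is us) -
     Ts (hd is) (\<Sum>k<n. alt_sign (n - Suc k) (\<rho> (map2 Ts (tl is) (omit k us)) (us ! k)))"

definition defect :: "(nat \<Rightarrow> 'v \<Rightarrow> 'g) \<Rightarrow> nat \<Rightarrow> 'v list \<Rightarrow> 'g" where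
  "defect Ts l us = (\<Sum>is\<in>weak_compositions n l. defect_summand Ts us is)"

lemma defect_summand_cong:
  assumes "is \<noteq> []" and eq: "\<And>i. i \<in> set is \<Longrightarrow> Rs i = Ts i"
  shows "defect_summand Rs us is = defect_summand Ts us is"
proof -
  have map2: "map2 Rs js xs = map2 Ts js xs" if "set js \<subseteq> set is" for js :: "nat list" and xs
    using that eq by (intro map_cong refl) (auto dest!: set_zip_leftD)
  have "set (tl is) \<subseteq> set is" "hd is \<in> set is"
    using assms(1) by (auto dest: list.set_sel)
  then show ?thesis
    unfolding defect_summand_def by (simp only: map2 subset_refl eq)
qed

lemma defect_cong:
  assumes "\<And>i. i \<le> l \<Longrightarrow> Rs i = Ts i"
  shows "defect Rs l us = defect Ts l us"
  unfolding defect_def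
proof (intro sum.cong refl defect_summand_cong)
  fix "is" i assume "is \<in> weak_compositions n l" "i \<in> set is"
  then show "Rs i = Ts i"
    using assms by (auto simp: weak_compositions_def member_le_sum_list)
qed (use n_pos in \<open>auto simp: weak_compositions_def\<close>)

text \<open>
  The compositions with a part \<open>m + 1\<close> in position \<open>j\<close> replace \<open>T u\<^sub>j\<close> by \<open>S u\<^sub>j\<close> in the bracket. In
  the other term, \<open>j = 0\<close> replaces the outer \<open>T\<close>, and \<open>j = q + 1\<close> the \<open>q\<close>-th argument of \<open>\<rho>\<close>.
  Together they give the product rule.
\<close>

lemma defect_top:
  assumes us: "length us = n" and "Ts 0 = T"
  shows "defect (Ts(Suc m := S)) (Suc m) us
    = obstruction n br \<rho> m Ts us + linearized_defect T S us"
proof -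
  let ?R = "Ts(Suc m := S)"
  have "(\<Sum>is\<in>{is. length is = n \<and> sum_list is = m + 1 \<and> (\<forall>i\<in>set is. i \<le> m)}. defect_summand ?R us is)
      = obstruction n br \<rho> m Ts us"
    unfolding obstruction_def defect_summand_def[symmetric]
    using n_pos by (intro sum.cong refl defect_summand_cong) auto
  moreover have "(\<Sum>j<n. defect_summand ?R us ((replicate n 0)[j := Suc m])) = linearized_defect T S us"
  proof -
    have n: "n = Suc (n - 1)" using n_pos by simp
    let ?e = "\<lambda>j. (replicate n 0)[j := Suc m]"
    let ?t = "\<lambda>j. ?R (hd (?e j)) (\<Sum>k<n. alt_sign (n - Suc k)
      (\<rho> (map2 ?R (tl (?e j)) (omit k us)) (us ! k)))"
    have e0: "hd (?e 0) = Suc m" "tl (?e 0) = replicate (n - 1) 0"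
      by (subst n, simp)+
    have eS: "hd (?e (Suc q)) = 0" "tl (?e (Suc q)) = (replicate (n - 1) 0)[q := Suc m]" for q
      by (subst n, simp)+
    have "map2 ?R (replicate (n - 1) 0) (omit k us) = map T (omit k us)" if "k < n" for k
      using assms(2) that us by (intro nth_equalityI) (auto simp: length_omit)
    then have "?t 0 = S (bracket_T \<rho> T us)"
      unfolding e0 bracket_T_def us by (simp del: fun_upd_apply add: fun_upd_same)
    moreover have "?t (Suc q) = T (\<Sum>k<n. alt_sign (n - Suc k)
        (\<rho> ((map T (omit k us))[q := S (omit k us ! q)]) (us ! k)))" if "q < n - 1" for q
    proof -
      have "map2 ?R ((replicate (n - 1) 0)[q := Suc m]) (omit k us)
          = (map T (omit k us))[q := S (omit k us ! q)]" if "k < n" for k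
        using map2_single_index[of q "omit k us" ?R "Suc m"] \<open>q < n - 1\<close> that us assms(2)
        by (simp add: length_omit)
      then show ?thesis unfolding eS using assms(2) by simp
    qed
    moreover have "(\<Sum>j<n. ?t j) = ?t 0 + (\<Sum>q<n - 1. ?t (Suc q))"
      using sum.lessThan_Suc_shift[of ?t "n - 1"] n by simp
    moreover have "br (map2 ?R (?e j) us) = br ((map T us)[j := S (us ! j)])" if "j < n" for j
      using map2_single_index[of j us ?R "Suc m"] that us assms(2) by simp
    ultimately show ?thesis
      unfolding linearized_defect_def defect_summand_def sum_subtractf
      by (simp add: algebra_simps del: fun_upd_apply)
  qed
  ultimately show ?thesis
    unfolding defect_def sum_weak_compositions_top by simp
qed

subsection \<open>The deformation equation degree by degree\<close>

lemma ext_T_const_coeffs: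
  assumes "\<forall>i\<le>m. Vector_Spaces.linear sv sg (Ts i)" "l \<le> m"
  shows "ext_T m Ts (const_coeffs u) l = Ts l u"
proof -
  have "(\<Sum>i\<le>l. Ts i (const_coeffs u (l - i))) = (\<Sum>i\<le>l. if i = l then Ts i u else 0)"
    using assms by (intro sum.cong refl) (auto simp: const_coeffs_def intro!: linear_zero[of sv sg])
  then show ?thesis using assms(2) by (simp add: ext_T_def)
qed

lemma map2_ext_T:
  assumes "\<forall>i\<le>m. Vector_Spaces.linear sv sg (Ts i)"
    and "length js = length xs" "\<forall>i\<in>set js. i \<le> m"
  shows "map2 (\<lambda>a i. a i) (map (\<lambda>u. ext_T m Ts (const_coeffs u)) xs) js = map2 Ts js xs"
  using assms by (intro nth_equalityI) (auto simp: ext_T_const_coeffs)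

lemma ext_rho_const_coeffs:
  assumes lin: "\<forall>i\<le>m. Vector_Spaces.linear sv sg (Ts i)"
    and "length xs = n - 1" "l \<le> m"
  shows "ext_rho m \<rho> (map (\<lambda>u. ext_T m Ts (const_coeffs u)) xs) (const_coeffs v) l
    = (\<Sum>js\<in>weak_compositions (n - 1) l. \<rho> (map2 Ts js xs) v)"
proof -
  let ?as = "map (\<lambda>u. ext_T m Ts (const_coeffs u)) xs"
  let ?I = "{(is, j). length is = length ?as \<and> sum_list is + j = l}"
  let ?J = "(\<lambda>js. (js, 0::nat)) ` weak_compositions (n - 1) l"
  have "?I \<subseteq> (\<Union>i\<le>l. weak_compositions (n - 1) i) \<times> {..l}"
    using assms by (auto simp: weak_compositions_def)
  then have "finite ?I"
    by (rule finite_subset) (auto simp: finite_weak_compositions)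
  then have "(\<Sum>(is, j)\<in>?I. \<rho> (map2 (\<lambda>a i. a i) ?as is) (const_coeffs v j))
      = (\<Sum>(is, j)\<in>?J. \<rho> (map2 (\<lambda>a i. a i) ?as is) (const_coeffs v j))"
  proof (rule sum.mono_neutral_right)
    show "?J \<subseteq> ?I" using assms by (auto simp: weak_compositions_def)
    show "\<forall>a\<in>?I - ?J. (case a of (is, j) \<Rightarrow> \<rho> (map2 (\<lambda>a i. a i) ?as is) (const_coeffs v j)) = 0"
    proof
      fix a assume a: "a \<in> ?I - ?J"
      obtain "is" j where aj: "a = (is, j)" by (cases a)
      with a have I: "length is = length ?as" "sum_list is + j = l" and J: "(is, j) \<notin> ?J"
        by auto
      \<comment> \<open>The vector is constant in \<open>t\<close>, so only its coefficient of degree 0 contributes.\<close>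
      have "j \<noteq> 0" using I J assms by (auto simp: weak_compositions_def)
      moreover have "length (map2 (\<lambda>a i. a i) ?as is) = n - 1" using I assms by simp
      ultimately show "(case a of (is, j) \<Rightarrow> \<rho> (map2 (\<lambda>a i. a i) ?as is) (const_coeffs v j)) = 0"
        by (simp only: aj prod.case const_coeffs_def if_False linear_zero[OF rho_linear])
    qed
  qed
  also have "\<dots> = (\<Sum>js\<in>weak_compositions (n - 1) l. \<rho> (map2 (\<lambda>a i. a i) ?as js) v)"
    by (subst sum.reindex) (auto simp: inj_on_def const_coeffs_def)
  also have "\<dots> = (\<Sum>js\<in>weak_compositions (n - 1) l. \<rho> (map2 Ts js xs) v)"
  proof (intro sum.cong refl)
    fix js assume js: "js \<in> weak_compositions (n - 1) l"
    have "\<forall>i\<in>set js. i \<le> m"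
      using js assms(3) member_le_sum_list by (fastforce simp: weak_compositions_def)
    then show "\<rho> (map2 (\<lambda>a i. a i) ?as js) v = \<rho> (map2 Ts js xs) v"
      using map2_ext_T[OF lin, of js xs] js assms(2) by (simp add: weak_compositions_def)
  qed
  finally show ?thesis using assms(3) by (simp add: ext_rho_def)
qed

text \<open>
  Truncation modulo \<open>t\<^sup>m\<^sup>+\<^sup>1\<close> is invisible in degrees \<open>l \<le> m\<close>, as the parts of a composition of \<open>l\<close> are at
  most \<open>l\<close>. So the equation of truncated polynomials splits into the equations for the coefficients.
\<close>

lemma order_deformation_iff:
  "order_deformation n sg br sv \<rho> T m Ts \<longleftrightarrow>
     Ts 0 = T \<and> (\<forall>i\<le>m. Vector_Spaces.linear sv sg (Ts i)) \<and>
     (\<forall>us l. length us = n \<and> l \<le> m \<longrightarrow> defect Ts l us = 0)"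
proof (cases "\<forall>i\<le>m. Vector_Spaces.linear sv sg (Ts i)")
  case True
  note lin = this
  have n: "n = Suc (n - 1)" using n_pos by simp
  define E where "E u = ext_T m Ts (const_coeffs u)" for u
  have br: "ext_bracket m br (map E us) l = (\<Sum>is\<in>weak_compositions n l. br (map2 Ts is us))"
    if "length us = n" "l \<le> m" for us l
  proof -
    have "ext_bracket m br (map E us) l
        = (\<Sum>is\<in>weak_compositions n l. br (map2 (\<lambda>a i. a i) (map E us) is))"
      using that by (simp add: ext_bracket_def weak_compositions_def)
    also have "\<dots> = (\<Sum>is\<in>weak_compositions n l. br (map2 Ts is us))"
    proof (intro sum.cong refl)
      fix "is" assume "is": "is \<in> weak_compositions n l"
      have "\<forall>i\<in>set is. i \<le> m"
        using "is" that(2) member_le_sum_list by (fastforce simp: weak_compositions_def)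
      then show "br (map2 (\<lambda>a i. a i) (map E us) is) = br (map2 Ts is us)"
        using map2_ext_T[OF lin, of "is" us] "is" that by (simp add: weak_compositions_def E_def[abs_def])
    qed
    finally show ?thesis .
  qed
  have \<rho>: "ext_T m Ts (\<lambda>l. \<Sum>i<n. alt_sign (n - Suc i)
        (ext_rho m \<rho> (map E (omit i us)) (const_coeffs (us ! i)) l)) l
      = (\<Sum>is\<in>weak_compositions n l. Ts (hd is)
          (\<Sum>k<n. alt_sign (n - Suc k) (\<rho> (map2 Ts (tl is) (omit k us)) (us ! k))))"
    if us: "length us = n" and l: "l \<le> m" for us l
  proof -
    have "(\<Sum>k<n. alt_sign (n - Suc k)
          (ext_rho m \<rho> (map E (omit k us)) (const_coeffs (us ! k)) (l - i)))
        = (\<Sum>js\<in>weak_compositions (n - 1) (l - i).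
            \<Sum>k<n. alt_sign (n - Suc k) (\<rho> (map2 Ts js (omit k us)) (us ! k)))" for i
    proof -
      have "ext_rho m \<rho> (map E (omit k us)) (const_coeffs (us ! k)) (l - i)
          = (\<Sum>js\<in>weak_compositions (n - 1) (l - i). \<rho> (map2 Ts js (omit k us)) (us ! k))"
        if "k < n" for k
        unfolding E_def[abs_def] using that us l
        by (intro ext_rho_const_coeffs[OF lin]) (simp_all add: length_omit)
      then show ?thesis
        by (simp add: alt_sign_sum) (rule sum.swap)
    qed
    then have "ext_T m Ts (\<lambda>l. \<Sum>i<n. alt_sign (n - Suc i)
        (ext_rho m \<rho> (map E (omit i us)) (const_coeffs (us ! i)) l)) l
      = (\<Sum>i\<le>l. \<Sum>js\<in>weak_compositions (n - 1) (l - i). Ts i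
          (\<Sum>k<n. alt_sign (n - Suc k) (\<rho> (map2 Ts js (omit k us)) (us ! k))))"
      using l by (simp add: ext_T_def) (intro sum.cong refl linear_sum[of sv sg] lin[rule_format], simp)
    also have "\<dots> = (\<Sum>is\<in>weak_compositions (Suc (n - 1)) l. Ts (hd is)
          (\<Sum>k<n. alt_sign (n - Suc k) (\<rho> (map2 Ts (tl is) (omit k us)) (us ! k))))"
      by (rule sum_weak_compositions_Suc[symmetric])
    finally show ?thesis using n by simp
  qed
  have "ext_bracket m br (map E us) = ext_T m Ts (\<lambda>l. \<Sum>i<n. alt_sign (n - Suc i)
        (ext_rho m \<rho> (map E (omit i us)) (const_coeffs (us ! i)) l))
      \<longleftrightarrow> (\<forall>l\<le>m. defect Ts l us = 0)" (is "?lhs = ?rhs \<longleftrightarrow> _") if us: "length us = n" for us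
  proof -
    have "?lhs l = ?rhs l" if "\<not> l \<le> m" for l
      using that by (simp_all add: ext_bracket_def ext_T_def)
    then have "?lhs = ?rhs \<longleftrightarrow> (\<forall>l\<le>m. ?lhs l = ?rhs l)"
      unfolding fun_eq_iff by blast
    then show ?thesis
      by (simp add: br[OF us] \<rho>[OF us] defect_def defect_summand_def sum_subtractf)
  qed
  then show ?thesis
    using True unfolding order_deformation_def E_def[abs_def] Let_def by auto
qed (auto simp: order_deformation_def)

lemma extendable_iff:
  assumes "order_deformation n sg br sv \<rho> T m Ts"
  shows "extendable n sg br sv \<rho> T m Ts \<longleftrightarrow>
    (\<exists>S. Vector_Spaces.linear sv sg S \<and>
      (\<forall>us. length us = n \<longrightarrow> obstruction n br \<rho> m Ts us + linearized_defect T S us = 0))"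
proof -
  have T: "Ts 0 = T" and lin: "\<forall>i\<le>m. Vector_Spaces.linear sv sg (Ts i)"
    and def0: "\<And>us l. length us = n \<Longrightarrow> l \<le> m \<Longrightarrow> defect Ts l us = 0"
    using assms by (auto simp: order_deformation_iff)
  have "order_deformation n sg br sv \<rho> T (Suc m) (Ts(Suc m := S)) \<longleftrightarrow>
      (\<forall>us. length us = n \<longrightarrow> obstruction n br \<rho> m Ts us + linearized_defect T S us = 0)"
    if S: "Vector_Spaces.linear sv sg S" for S
  proof -
    have "defect (Ts(Suc m := S)) l us = 0" if "length us = n" "l \<le> m" for l us
      using defect_cong[of l "Ts(Suc m := S)" Ts us] def0[OF that] that by simp
    moreover have "(Ts(Suc m := S)) 0 = T"
      "\<forall>i\<le>Suc m. Vector_Spaces.linear sv sg ((Ts(Suc m := S)) i)"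
      using T lin S by (auto simp: le_Suc_eq)
    ultimately have "order_deformation n sg br sv \<rho> T (Suc m) (Ts(Suc m := S)) \<longleftrightarrow>
        (\<forall>us. length us = n \<longrightarrow> defect (Ts(Suc m := S)) (Suc m) us = 0)"
      unfolding order_deformation_iff le_Suc_eq by blast
    then show ?thesis by (simp add: defect_top[where T = T] T)
  qed
  then show ?thesis unfolding extendable_def by blast
qed

end

section \<open>Extendability and the obstruction class\<close>

lemma lie_rep_data_of_pair:
  assumes "n \<ge> 2" "n_LieRep_pair n sg br sv \<rho>"
  shows "lie_rep_data n sg sv br \<rho>"
  using assms
  by (simp add: lie_rep_data_def n_LieRep_pair_def n_Lie_algebra_def n_Lie_representation_def)

theorem theorem5p6:
  fixes n m :: nat
    and sg :: "'k::{alg_closed_field, field_char_0} \<Rightarrow> 'g::ab_group_add \<Rightarrow> 'g"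
    and sv :: "'k \<Rightarrow> 'v::ab_group_add \<Rightarrow> 'v"
    and br :: "'g list \<Rightarrow> 'g"
    and \<rho> :: "'g list \<Rightarrow> 'v \<Rightarrow> 'v"
    and T :: "'v \<Rightarrow> 'g"
    and Ts :: "nat \<Rightarrow> 'v \<Rightarrow> 'g"
  assumes "n \<ge> 2"
    and "n_LieRep_pair n sg br sv \<rho>"
    and "relative_Rota_Baxter n sg br sv \<rho> T"
    and "order_deformation n sg br sv \<rho> T m Ts"
  shows "extendable n sg br sv \<rho> T m Ts \<longleftrightarrow>
    cohomology_class n sg br sv \<rho> T 2 (two_cochain n (obstruction n br \<rho> m Ts))
      = \<one>\<^bsub>cohomology_group n sg br sv \<rho> T 2\<^esub>"
proof -
  interpret lie_rep_data n sg sv br \<rho>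
    by (rule lie_rep_data_of_pair) fact+
  have T: "Vector_Spaces.linear sv sg T"
    using assms(3) by (simp add: relative_Rota_Baxter_def)
  let ?\<Theta> = "obstruction n br \<rho> m Ts"
  have "extendable n sg br sv \<rho> T m Ts \<longleftrightarrow> (\<exists>S. Vector_Spaces.linear sv sg S \<and>
      (\<forall>us. length us = n \<longrightarrow> ?\<Theta> us + linearized_defect T S us = 0))"
    by (rule extendable_iff[OF assms(4)])
  also have "\<dots> \<longleftrightarrow> (\<exists>S. Vector_Spaces.linear sv sg S \<and>
      (\<forall>us. length us = n \<longrightarrow> ?\<Theta> us = linearized_defect T S us))" (is "?ext \<longleftrightarrow> ?cob")
  proof
    assume ?ext
    then obtain S where "Vector_Spaces.linear sv sg S"
      "\<And>us. length us = n \<Longrightarrow> ?\<Theta> us + linearized_defect T S us = 0"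
      by blast
    then show ?cob
      by (intro exI[of _ "\<lambda>u. - S u"])
        (simp add: linear_pointwise_neg linearized_defect_neg[OF T] eq_neg_iff_add_eq_0)
  next
    assume ?cob
    then obtain S where "Vector_Spaces.linear sv sg S"
      "\<And>us. length us = n \<Longrightarrow> ?\<Theta> us = linearized_defect T S us"
      by blast
    then show ?ext
      by (intro exI[of _ "\<lambda>u. - S u"])
        (simp add: linear_pointwise_neg linearized_defect_neg[OF T])
  qed
  also have "\<dots> \<longleftrightarrow> cohomology_class n sg br sv \<rho> T 2 (two_cochain n ?\<Theta>)
      = \<one>\<^bsub>cohomology_group n sg br sv \<rho> T 2\<^esub>"
    by (rule cohomology_class_trivial_iff[OF T, symmetric])
  finally show ?thesis .
qed

end
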